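(* Let $A,B:\mathbb{R}^n\rightrightarrows\mathbb{R}^n$ be maximal monotone operators with $(A+B)^{-1}(0)\ne\emptyset$, and suppose a $\mathcal{B}$-procedure (see context) is given. Consider the sequences generated by Algorithm 2 (see context), where $\alpha\in[0,1)$, $\overline\rho\in(0,2)$ and $\{\alpha_k\}$ satisfy, for some $\beta>0$, $0\le\alpha_k\le\alpha_{k+1}\le\alpha<\beta<1$ for all $k\ge0$, and $\overline\rho=\dfrac{2(\beta-1)^2}{2(\beta-1)^2+3\beta-1}$. Then: (a) If the outer loop (over $k$) executes an infinite number of times, with each inner loop (over $\ell$) terminating in a finite number of iterations $\ell=\ell(k)$, then $\{s^k\}$ and $\{r^k\}$ both converge to some $x^*\in\mathbb{R}^n$ with $0\in A(x^* )+B(x^* )$, and $\{b^{k,\ell(k)}\}$ and $\{b^k\}$ both converge to some $b^*\in B(x^* )$, with $\{a^{k,\ell(k)}\}$ converging to $-b^*\in A(x^* )$. (b) If the outer loop executes only a finite number of times, ending with $k=\bar k$, with the last invocation of the inner loop executing an infinite number of times, then $\{s^{\bar k,\ell}\}_{\ell=1}^\infty$ and $\{r^{\bar k,\ell}\}_{\ell=1}^\infty$ both converge to some $x^*\in\mathbb{R}^n$ with $0\in A(x^* )+B(x^* )$, and $\{b^{\bar k,\ell}\}_{\ell=1}^\infty$ converges to some $b^*\in B(x^* )$, with $\{a^{\bar k,\ell}\}_{\ell=1}^\infty$ converging to $-b^*\in A(x^* )$. (c) If Algorithm 2 stops with $s^{k,\ell}=r^{k,\ell}$, then $z^*:=s^{k,\ell}=r^{k,\ell}$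 satisfies $0\in A(z^* )+B(z^* )$.
   Context: $\mathbb{N}^*=\{1,2,\dots\}$, $\mathbb{R}_{++}=(0,\infty)$; $\langle\cdot,\cdot\rangle,\|\cdot\|$ are Euclidean. $\mathcal{B}$-procedure (for the operator $B$): a mapping $\mathcal{B}:\mathbb{R}^n\times\mathbb{R}^n\times\mathbb{R}_{++}\times\mathbb{R}^n\times\mathbb{R}^n\times\mathbb{N}^*\to\mathbb{R}^n\times\mathbb{R}^n$ such that for any $r,b,\bar s,\bar b\in\mathbb{R}^n$ and $\gamma>0$, letting $(s^\ell,b^\ell)=\mathcal{B}(r,b,\gamma,\bar s,\bar b,\ell)$ for all $\ell\in\mathbb{N}^*$, one has $b^\ell\in B(s^\ell)$ for all $\ell$, the sequence $\{(s^\ell,b^\ell)\}$ is convergent, and $s^\ell+\gamma b^\ell\to r+\gamma b$. Algorithm 2. Choose $\gamma>0$, $0\le\alpha,\sigma<1$, $0<\underline\rho<\overline\rho<2$, and $(s^0,b^0,r^0)=(s^{-1},b^{-1},r^{-1})\in(\mathbb{R}^n)^3$. For $k=0,1,2,\dots$ (outer loop): (1) choose $\alpha_k\in[0,\alpha]$ and set $(\hat s^k,\hat b^k,\hat r^k)=(s^k,b^k,r^k)+\alpha_k[(s^k,b^k,r^k)-(s^{k-1},b^{k-1},r^{k-1})]$; (2) (inner loop) repeat for $\ell=1,2,\dots$: set $(s^{k,\ell},b^{k,\ell})=\mathcal{B}(\hat r^k,\hat b^k,\gamma,\hat s^k,\hat b^k,\ell)$ and exactly find $(r^{k,\ell},a^{k,\ell})\in\mathbb{R}^n\times\mathbb{R}^n$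 with $a^{k,\ell}\in A(r^{k,\ell})$ and $r^{k,\ell}+\gamma a^{k,\ell}=s^{k,\ell}-\gamma b^{k,\ell}$; until $$\|s^{k,\ell}+\gamma b^{k,\ell}-(\hat r^k+\gamma\hat b^k)\|^2\le\sigma^2\left(\|r^{k,\ell}+\gamma b^{k,\ell}-(\hat r^k+\gamma\hat b^k)\|^2+\|s^{k,\ell}-r^{k,\ell}\|^2\right);$$ (3) with $\ell=\ell(k)$ the terminating inner index: if $s^{k,\ell}=r^{k,\ell}$, stop; otherwise choose $\rho_k\in[\underline\rho,\overline\rho]$ and set $s^{k+1}=s^{k,\ell}$, $r^{k+1}=r^{k,\ell}$, $$\theta_{k+1}=\frac{\langle(\hat r^k-r^{k,\ell})+\gamma(\hat b^k-b^{k,\ell}),\,s^{k,\ell}-r^{k,\ell}\rangle}{\|s^{k,\ell}-r^{k,\ell}\|^2},$$ $$b^{k+1}=\hat b^k-\gamma^{-1}\left[(1-\rho_k\theta_{k+1})r^{k+1}+\rho_k\theta_{k+1}s^{k+1}-\hat r^k\right].$$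
   Formalization: Part (b) is stated for σ > 0 only: for σ = 0 the inner test demands exact equality, which a B-procedure need only meet in the limit, and (b) fails (e.g. A(x)={x}, B(x)={0}, s^ℓ = r+γb+1/ℓ, b^ℓ = 0). *)

theory Defs
  imports "HOL-Analysis.Analysis" "HOL-Library.Set_Algebras"
begin

text \<open>Set-valued operators are functions into sets; \<open>A x + B x\<close> is the elementwise sum of sets.\<close>

definition monotone_operator :: "('a::real_inner \<Rightarrow> 'a set) \<Rightarrow> bool" where
  "monotone_operator A \<longleftrightarrow> (\<forall>x y. \<forall>u\<in>A x. \<forall>v\<in>A y. 0 \<le> (x - y) \<bullet> (u - v))"

definition maximal_monotone :: "('a::real_inner \<Rightarrow> 'a set) \<Rightarrow> bool" where
  "maximal_monotone A \<longleftrightarrow> monotone_operator A \<and>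
     (\<forall>A'. monotone_operator A' \<longrightarrow> (\<forall>x. A x \<subseteq> A' x) \<longrightarrow> A' = A)"

text \<open>
  The last argument of a procedure is the inner iteration number \<open>\<ell> \<ge> 1\<close>;
  its value at \<open>\<ell> = 0\<close> is irrelevant.
\<close>

type_synonym 'a procedure = "'a \<Rightarrow> 'a \<Rightarrow> real \<Rightarrow> 'a \<Rightarrow> 'a \<Rightarrow> nat \<Rightarrow> 'a \<times> 'a"

definition B_procedure :: "('a::real_inner \<Rightarrow> 'a set) \<Rightarrow> 'a procedure \<Rightarrow> bool" where
  "B_procedure B P \<longleftrightarrow>
     (\<forall>r b \<gamma> s' b'. 0 < \<gamma> \<longrightarrow>
        (\<forall>l\<ge>1. snd (P r b \<gamma> s' b' l) \<in> B (fst (P r b \<gamma> s' b' l))) \<and>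
        convergent (P r b \<gamma> s' b') \<and>
        (\<lambda>l. fst (P r b \<gamma> s' b' l) + \<gamma> *\<^sub>R snd (P r b \<gamma> s' b' l)) \<longlonglongrightarrow> r + \<gamma> *\<^sub>R b)"

text \<open>
  The quantities of one execution: outer iterates \<open>s\<^sup>k, b\<^sup>k, r\<^sup>k\<close>,
  extrapolated points, inner iterates with index pair \<open>k, \<ell>\<close> (\<open>\<ell> \<ge> 1\<close>),
  the chosen inertial and relaxation parameters, the numbers \<open>\<theta>\<^sub>k\<close>, and the
  terminating inner index \<open>\<ell>(k)\<close>. The fields are total functions, but only the entries
  actually computed by an execution are constrained below.
\<close>

record 'a execution =
  out_s :: "nat \<Rightarrow> 'a"
  out_b :: "nat \<Rightarrow> 'a"
  out_r :: "nat \<Rightarrow> 'a"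
  hat_s :: "nat \<Rightarrow> 'a"
  hat_b :: "nat \<Rightarrow> 'a"
  hat_r :: "nat \<Rightarrow> 'a"
  in_s :: "nat \<Rightarrow> nat \<Rightarrow> 'a"
  in_b :: "nat \<Rightarrow> nat \<Rightarrow> 'a"
  in_r :: "nat \<Rightarrow> nat \<Rightarrow> 'a"
  in_a :: "nat \<Rightarrow> nat \<Rightarrow> 'a"
  inertia :: "nat \<Rightarrow> real"
  relax :: "nat \<Rightarrow> real"
  theta :: "nat \<Rightarrow> real"
  ell :: "nat \<Rightarrow> nat"

text \<open>
  Truncated subtraction on the naturals gives \<open>0 - 1 = 0\<close>, which encodes the convention
  \<open>(s\<^sup>-\<^sup>1, b\<^sup>-\<^sup>1, r\<^sup>-\<^sup>1) = (s\<^sup>0, b\<^sup>0, r\<^sup>0)\<close>.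
\<close>

definition extrapolation_step :: "real \<Rightarrow> 'a::real_inner execution \<Rightarrow> nat \<Rightarrow> bool" where
  "extrapolation_step \<alpha> E k \<longleftrightarrow>
     inertia E k \<in> {0..\<alpha>} \<and>
     hat_s E k = out_s E k + inertia E k *\<^sub>R (out_s E k - out_s E (k - 1)) \<and>
     hat_b E k = out_b E k + inertia E k *\<^sub>R (out_b E k - out_b E (k - 1)) \<and>
     hat_r E k = out_r E k + inertia E k *\<^sub>R (out_r E k - out_r E (k - 1))"

definition inner_step ::
  "('a::real_inner \<Rightarrow> 'a set) \<Rightarrow> 'a procedure \<Rightarrow> real \<Rightarrow> 'a execution \<Rightarrow> nat \<Rightarrow> nat \<Rightarrow> bool" where
  "inner_step A P \<gamma> E k l \<longleftrightarrow>
     (in_s E k l, in_b E k l) = P (hat_r E k) (hat_b E k) \<gamma> (hat_s E k) (hat_b E k) l \<and>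
     in_a E k l \<in> A (in_r E k l) \<and>
     in_r E k l + \<gamma> *\<^sub>R in_a E k l = in_s E k l - \<gamma> *\<^sub>R in_b E k l"

definition inner_test :: "real \<Rightarrow> real \<Rightarrow> 'a::real_inner execution \<Rightarrow> nat \<Rightarrow> nat \<Rightarrow> bool" where
  "inner_test \<gamma> \<sigma> E k l \<longleftrightarrow>
     (norm (in_s E k l + \<gamma> *\<^sub>R in_b E k l - (hat_r E k + \<gamma> *\<^sub>R hat_b E k)))\<^sup>2 \<le>
     \<sigma>\<^sup>2 * ((norm (in_r E k l + \<gamma> *\<^sub>R in_b E k l - (hat_r E k + \<gamma> *\<^sub>R hat_b E k)))\<^sup>2
            + (norm (in_s E k l - in_r E k l))\<^sup>2)"

definition inner_loop_finite ::
  "('a::real_inner \<Rightarrow> 'a set) \<Rightarrow> 'a procedure \<Rightarrow> real \<Rightarrow> real \<Rightarrow> 'a execution \<Rightarrow> nat \<Rightarrow> bool" where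
  "inner_loop_finite A P \<gamma> \<sigma> E k \<longleftrightarrow>
     1 \<le> ell E k \<and>
     (\<forall>l\<in>{1..ell E k}. inner_step A P \<gamma> E k l) \<and>
     (\<forall>l\<in>{1..<ell E k}. \<not> inner_test \<gamma> \<sigma> E k l) \<and>
     inner_test \<gamma> \<sigma> E k (ell E k)"

definition inner_loop_infinite ::
  "('a::real_inner \<Rightarrow> 'a set) \<Rightarrow> 'a procedure \<Rightarrow> real \<Rightarrow> real \<Rightarrow> 'a execution \<Rightarrow> nat \<Rightarrow> bool" where
  "inner_loop_infinite A P \<gamma> \<sigma> E k \<longleftrightarrow>
     (\<forall>l\<ge>1. inner_step A P \<gamma> E k l \<and> \<not> inner_test \<gamma> \<sigma> E k l)"

definition update_step :: "real \<Rightarrow> real \<Rightarrow> real \<Rightarrow> 'a::real_inner execution \<Rightarrow> nat \<Rightarrow> bool" where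
  "update_step \<gamma> \<rho>lo \<rho>hi E k \<longleftrightarrow>
     relax E k \<in> {\<rho>lo..\<rho>hi} \<and>
     out_s E (Suc k) = in_s E k (ell E k) \<and>
     out_r E (Suc k) = in_r E k (ell E k) \<and>
     theta E (Suc k) =
       (((hat_r E k - in_r E k (ell E k)) + \<gamma> *\<^sub>R (hat_b E k - in_b E k (ell E k)))
          \<bullet> (in_s E k (ell E k) - in_r E k (ell E k)))
       / (norm (in_s E k (ell E k) - in_r E k (ell E k)))\<^sup>2 \<and>
     out_b E (Suc k) = hat_b E k - (1 / \<gamma>) *\<^sub>R
       ((1 - relax E k * theta E (Suc k)) *\<^sub>R out_r E (Suc k)
        + (relax E k * theta E (Suc k)) *\<^sub>R out_s E (Suc k) - hat_r E k)"

definition full_pass ::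
  "('a::real_inner \<Rightarrow> 'a set) \<Rightarrow> 'a procedure \<Rightarrow> real \<Rightarrow> real \<Rightarrow> real \<Rightarrow> real \<Rightarrow> real
     \<Rightarrow> 'a execution \<Rightarrow> nat \<Rightarrow> bool" where
  "full_pass A P \<gamma> \<alpha> \<sigma> \<rho>lo \<rho>hi E k \<longleftrightarrow>
     extrapolation_step \<alpha> E k \<and>
     inner_loop_finite A P \<gamma> \<sigma> E k \<and>
     in_s E k (ell E k) \<noteq> in_r E k (ell E k) \<and>
     update_step \<gamma> \<rho>lo \<rho>hi E k"

text \<open>
  The three possible kinds of execution. For \<open>\<sigma> = 0\<close> the test demands an exact equality
  that a procedure need only meet in the limit, so a stuck inner loop then carries no information
  on \<open>in_s - in_r\<close>; convergence of a stuck loop to a solution can be expected for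
  \<open>\<sigma> > 0\<close> only.
\<close>

definition runs_forever ::
  "('a::real_inner \<Rightarrow> 'a set) \<Rightarrow> 'a procedure \<Rightarrow> real \<Rightarrow> real \<Rightarrow> real \<Rightarrow> real \<Rightarrow> real
     \<Rightarrow> 'a execution \<Rightarrow> bool" where
  "runs_forever A P \<gamma> \<alpha> \<sigma> \<rho>lo \<rho>hi E \<longleftrightarrow> (\<forall>k. full_pass A P \<gamma> \<alpha> \<sigma> \<rho>lo \<rho>hi E k)"

definition inner_loop_stuck_at ::
  "('a::real_inner \<Rightarrow> 'a set) \<Rightarrow> 'a procedure \<Rightarrow> real \<Rightarrow> real \<Rightarrow> real \<Rightarrow> real \<Rightarrow> real
     \<Rightarrow> 'a execution \<Rightarrow> nat \<Rightarrow> bool" where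
  "inner_loop_stuck_at A P \<gamma> \<alpha> \<sigma> \<rho>lo \<rho>hi E k \<longleftrightarrow>
     (\<forall>j<k. full_pass A P \<gamma> \<alpha> \<sigma> \<rho>lo \<rho>hi E j) \<and>
     extrapolation_step \<alpha> E k \<and>
     inner_loop_infinite A P \<gamma> \<sigma> E k"

definition stops_at ::
  "('a::real_inner \<Rightarrow> 'a set) \<Rightarrow> 'a procedure \<Rightarrow> real \<Rightarrow> real \<Rightarrow> real \<Rightarrow> real \<Rightarrow> real
     \<Rightarrow> 'a execution \<Rightarrow> nat \<Rightarrow> bool" where
  "stops_at A P \<gamma> \<alpha> \<sigma> \<rho>lo \<rho>hi E k \<longleftrightarrow>
     (\<forall>j<k. full_pass A P \<gamma> \<alpha> \<sigma> \<rho>lo \<rho>hi E j) \<and>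
     extrapolation_step \<alpha> E k \<and>
     inner_loop_finite A P \<gamma> \<sigma> E k \<and>
     in_s E k (ell E k) = in_r E k (ell E k)"

end

theory Submission
  imports Defs
begin

text \<open>
  Write \<open>p\<^sup>k = r\<^sup>k + \<gamma> b\<^sup>k\<close>. In terms of \<open>p\<close> an outer pass is a single inertial, relaxed projection
  step. With \<open>y = r\<^sup>k\<^sup>,\<^sup>\<ell> + \<gamma> b\<^sup>k\<^sup>,\<^sup>\<ell>\<close> and \<open>v = s\<^sup>k\<^sup>,\<^sup>\<ell> - r\<^sup>k\<^sup>,\<^sup>\<ell>\<close>, the definitions of \<open>\<theta>\<close> and of the new \<open>b\<close>
  say that \<open>p\<^sup>k\<^sup>+\<^sup>1\<close> arises from the extrapolated point by moving \<open>\<rho>\<close> times the way to its projection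
  onto the half-space \<open>{z. (z - y) \<bullet> v \<le> 0}\<close>. Monotonicity of \<open>A\<close> and \<open>B\<close> puts every
  \<open>x + \<gamma> b\<close> with \<open>b \<in> B x\<close>, \<open>- b \<in> A x\<close> into that half-space (\<open>splitting_separation\<close>), and
  the inner stopping test forces the step to be at least a fixed multiple of both \<open>\<parallel>v\<parallel>\<close> and the
  distance from \<open>y\<close> to the extrapolated point
  (\<open>relative_error_inner\<close>, \<open>relaxed_projection_long\<close>).

  A relaxed projection decreases the squared distance to each such point by \<open>(2 - \<rho>) / \<rho>\<close> times
  the squared step. Inertia spoils this monotonicity, but an energy that combines two
  consecutive distances with the last displacement still decreases, as long as
  \<open>\<alpha> (1 + \<alpha>) < \<eta> (1 - \<alpha>)\<^sup>2\<close>, where \<open>\<eta> = (2 - \<rho>hi) / \<rho>hi\<close>.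
  The prescribed upper bound for the relaxation is exactly the one with \<open>\<eta> (1 - \<beta>)\<^sup>2 = \<beta> (1 + \<beta>)\<close>, so the condition follows from \<open>\<alpha> < \<beta>\<close>. Hence \<open>p\<close> is bounded and
  its steps vanish. Then \<open>v\<close> vanishes too and \<open>s\<^sup>k\<^sup>,\<^sup>\<ell> + \<gamma> b\<^sup>k\<^sup>,\<^sup>\<ell> = y + v\<close> approaches \<open>p\<close>;
  since resolvents of monotone operators are
  nonexpansive and graphs of maximal monotone operators are closed (\<open>splitting_limit\<close>), every cluster
  point of \<open>p\<close> has the form \<open>x + \<gamma> b\<close> above. Comparing the energies along the whole
  sequence and along a subsequence gives convergence of \<open>p\<close> (\<open>cluster_point_is_limit\<close>), and a second
  use of \<open>splitting_limit\<close> splits its limit into those of the individual sequences.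

  An inner loop that never ends has a vanishing left-hand side in its failing test, so for \<open>\<sigma> > 0\<close>
  again \<open>v\<close> vanishes and \<open>splitting_limit\<close> applies. If the method stops, then \<open>a = - b\<close> at once.
\<close>

section \<open>Monotone operators and resolvents\<close>

lemma monotone_operatorD:
  assumes "monotone_operator A" "u \<in> A x" "v \<in> A y"
  shows "0 \<le> (x - y) \<bullet> (u - v)"
  using assms unfolding monotone_operator_def by blast

text \<open>
  A limit of points of the graph is monotonically related to the whole graph, so
  adding it to the operator keeps monotonicity; maximality says that it was there already.
\<close>

lemma maximal_monotone_closed_graph:
  assumes max: "maximal_monotone A"
    and mem: "\<And>n. u n \<in> A (x n)" and x: "x \<longlonglongrightarrow> x'" and u: "u \<longlonglongrightarrow> u'"
  shows "u' \<in> A x'"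
proof -
  have mono: "monotone_operator A"
    using max by (simp add: maximal_monotone_def)
  define A' where "A' y = (if y = x' then insert u' (A y) else A y)" for y
  have related: "0 \<le> (x' - y) \<bullet> (u' - v)" if "v \<in> A y" for y v
  proof (rule LIMSEQ_le_const)
    show "(\<lambda>n. (x n - y) \<bullet> (u n - v)) \<longlonglongrightarrow> (x' - y) \<bullet> (u' - v)"
      by (intro tendsto_intros x u)
    show "\<exists>N. \<forall>n\<ge>N. 0 \<le> (x n - y) \<bullet> (u n - v)"
      using monotone_operatorD[OF mono mem that] by blast
  qed
  have related': "0 \<le> (y - x') \<bullet> (v - u')" if "v \<in> A y" for y v
    using related[OF that] by (simp add: inner_diff_left inner_diff_right)
  have "monotone_operator A'"
    unfolding monotone_operator_def A'_def
    using related related' monotone_operatorD[OF mono] by (auto split: if_splits)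
  moreover have "\<forall>y. A y \<subseteq> A' y"
    by (auto simp: A'_def)
  ultimately have "A' = A"
    using max by (simp add: maximal_monotone_def)
  moreover have "u' \<in> A' x'"
    by (simp add: A'_def)
  ultimately show ?thesis
    by simp
qed

lemma resolvent_nonexpansive:
  assumes "monotone_operator A" "u \<in> A x" "v \<in> A y" "0 \<le> \<gamma>"
  shows "norm (x - y) \<le> norm ((x + \<gamma> *\<^sub>R u) - (y + \<gamma> *\<^sub>R v))"
proof -
  have "(norm (x - y))\<^sup>2 + \<gamma> * ((x - y) \<bullet> (u - v)) = (x - y) \<bullet> ((x + \<gamma> *\<^sub>R u) - (y + \<gamma> *\<^sub>R v))"
    by (simp add: power2_norm_eq_inner algebra_simps)
  also have "\<dots> \<le> norm (x - y) * norm ((x + \<gamma> *\<^sub>R u) - (y + \<gamma> *\<^sub>R v))"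
    by (rule norm_cauchy_schwarz)
  finally have "norm (x - y) * norm (x - y) \<le> norm (x - y) * norm ((x + \<gamma> *\<^sub>R u) - (y + \<gamma> *\<^sub>R v))"
    using mult_nonneg_nonneg[OF assms(4) monotone_operatorD[OF assms(1-3)]]
    by (simp add: power2_eq_square)
  then show ?thesis
    by (cases "norm (x - y) = 0") (auto simp: mult_le_cancel_left)
qed

text \<open>
  Only the sum \<open>s + \<gamma> b\<close> is known to converge; nonexpansiveness of the resolvent makes \<open>s\<close> a Cauchy
  sequence as well.
\<close>

lemma resolvent_sequence_converges:
  fixes s b :: "nat \<Rightarrow> 'a::{real_inner, complete_space}"
  assumes max: "maximal_monotone B" and \<gamma>: "0 < \<gamma>"
    and mem: "\<And>n. b n \<in> B (s n)" and lim: "(\<lambda>n. s n + \<gamma> *\<^sub>R b n) \<longlonglongrightarrow> p"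
  obtains x c where "s \<longlonglongrightarrow> x" "b \<longlonglongrightarrow> c" "c \<in> B x" "p = x + \<gamma> *\<^sub>R c"
proof -
  have mono: "monotone_operator B"
    using max by (simp add: maximal_monotone_def)
  have "Cauchy s"
    unfolding Cauchy_def
  proof (intro allI impI)
    fix e :: real assume "0 < e"
    moreover have "Cauchy (\<lambda>n. s n + \<gamma> *\<^sub>R b n)"
      using lim by (intro convergent_Cauchy convergentI)
    ultimately obtain M where M:
      "\<And>m n. M \<le> m \<Longrightarrow> M \<le> n \<Longrightarrow> dist (s m + \<gamma> *\<^sub>R b m) (s n + \<gamma> *\<^sub>R b n) < e"
      unfolding Cauchy_def by blast
    have "dist (s m) (s n) < e" if "M \<le> m" "M \<le> n" for m n
      using resolvent_nonexpansive[OF mono mem[of m] mem[of n], of \<gamma>] M[OF that] \<gamma>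
      by (simp add: dist_norm)
    then show "\<exists>M. \<forall>m\<ge>M. \<forall>n\<ge>M. dist (s m) (s n) < e"
      by blast
  qed
  then obtain x where x: "s \<longlonglongrightarrow> x"
    using Cauchy_convergent convergent_def by blast
  have "(\<lambda>n. (1 / \<gamma>) *\<^sub>R ((s n + \<gamma> *\<^sub>R b n) - s n)) \<longlonglongrightarrow> (1 / \<gamma>) *\<^sub>R (p - x)"
    by (intro tendsto_intros lim x)
  then have b: "b \<longlonglongrightarrow> (1 / \<gamma>) *\<^sub>R (p - x)"
    using \<gamma> by simp
  show thesis
  proof (rule that[OF x b])
    show "(1 / \<gamma>) *\<^sub>R (p - x) \<in> B x"
      by (rule maximal_monotone_closed_graph[OF max mem x b])
    show "p = x + \<gamma> *\<^sub>R ((1 / \<gamma>) *\<^sub>R (p - x))"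
      using \<gamma> by simp
  qed
qed

section \<open>The splitting operator\<close>

text \<open>
  The points \<open>x + \<gamma> b\<close> from which the solution \<open>x\<close> and its dual certificate \<open>b\<close> can be read off:
  the zeros of the Eckstein-Bertsekas splitting operator, equivalently the fixed points
  of the Douglas-Rachford map.
\<close>

definition splitting_zeros ::
  "('a::real_inner \<Rightarrow> 'a set) \<Rightarrow> ('a \<Rightarrow> 'a set) \<Rightarrow> real \<Rightarrow> 'a set" where
  "splitting_zeros A B \<gamma> = {x + \<gamma> *\<^sub>R b | x b. b \<in> B x \<and> - b \<in> A x}"

lemma zero_in_set_sumI:
  fixes b :: "'a::group_add"
  assumes "b \<in> Y" "- b \<in> X"
  shows "0 \<in> X + Y"
  using set_plus_intro[OF assms(2,1)] by simp

lemma splitting_zeros_nonempty: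
  assumes "{x. 0 \<in> A x + B x} \<noteq> {}"
  shows "splitting_zeros A B \<gamma> \<noteq> {}"
proof -
  obtain x where "0 \<in> A x + B x"
    using assms by blast
  then obtain a b where "0 = a + b" "a \<in> A x" "b \<in> B x"
    by (rule set_plus_elim)
  moreover from this have "a = - b"
    by (simp add: eq_neg_iff_add_eq_0)
  ultimately show ?thesis
    unfolding splitting_zeros_def by blast
qed

text \<open>
  Since \<open>s - r = \<gamma> (a + b)\<close>, the inner product below equals
  \<open>\<gamma> (r - x) \<bullet> (a + c) + \<gamma> (s - x) \<bullet> (b - c)\<close> for \<open>z = x + \<gamma> c\<close>, and monotonicity makes both
  summands nonnegative.
\<close>

lemma splitting_separation:
  assumes A: "monotone_operator A" and B: "monotone_operator B" and \<gamma>: "0 < \<gamma>"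
    and a: "a \<in> A r" and b: "b \<in> B s" and res: "r + \<gamma> *\<^sub>R a = s - \<gamma> *\<^sub>R b"
    and z: "z \<in> splitting_zeros A B \<gamma>"
  shows "0 \<le> (r + \<gamma> *\<^sub>R b - z) \<bullet> (s - r)"
proof -
  obtain x c where z_eq: "z = x + \<gamma> *\<^sub>R c" and c: "c \<in> B x" "- c \<in> A x"
    using z unfolding splitting_zeros_def by blast
  have s: "s = r + \<gamma> *\<^sub>R (a + b)"
    using res by (simp add: algebra_simps)
  have "(r + \<gamma> *\<^sub>R b - z) \<bullet> (s - r)
      = \<gamma> * ((r - x) \<bullet> (a - - c)) + \<gamma> * ((s - x) \<bullet> (b - c))"
    unfolding z_eq s by (simp add: algebra_simps inner_commute)
  moreover have "0 \<le> (r - x) \<bullet> (a - - c)"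
    by (rule monotone_operatorD[OF A a c(2)])
  moreover have "0 \<le> (s - x) \<bullet> (b - c)"
    by (rule monotone_operatorD[OF B b c(1)])
  ultimately show ?thesis
    using \<gamma> by simp
qed

text \<open>
  The common end of all convergence arguments: control of \<open>s + \<gamma> b\<close> and of the gap
  \<open>s - r\<close> suffices for convergence of all four sequences to a primal-dual solution.
\<close>

lemma splitting_limit:
  fixes s r a b :: "nat \<Rightarrow> 'a::{real_inner, complete_space}"
  assumes A: "maximal_monotone A" and B: "maximal_monotone B" and \<gamma>: "0 < \<gamma>"
    and a: "\<And>n. a n \<in> A (r n)" and b: "\<And>n. b n \<in> B (s n)"
    and res: "\<And>n. r n + \<gamma> *\<^sub>R a n = s n - \<gamma> *\<^sub>R b n"
    and lim: "(\<lambda>n. s n + \<gamma> *\<^sub>R b n) \<longlonglongrightarrow> p" and gap: "(\<lambda>n. s n - r n) \<longlonglongrightarrow> 0"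
  obtains x c where "c \<in> B x" "- c \<in> A x" "p = x + \<gamma> *\<^sub>R c"
    "s \<longlonglongrightarrow> x" "r \<longlonglongrightarrow> x" "b \<longlonglongrightarrow> c" "a \<longlonglongrightarrow> - c"
proof -
  obtain x c where x: "s \<longlonglongrightarrow> x" and c: "b \<longlonglongrightarrow> c" "c \<in> B x" and p: "p = x + \<gamma> *\<^sub>R c"
    using resolvent_sequence_converges[OF B \<gamma> b lim] by blast
  have r: "r \<longlonglongrightarrow> x"
    using tendsto_diff[OF x gap] by simp
  have "\<gamma> *\<^sub>R a n = (s n - r n) - \<gamma> *\<^sub>R b n" for n
    using res[of n] by (simp add: algebra_simps)
  then have "(1 / \<gamma>) *\<^sub>R \<gamma> *\<^sub>R a n = (1 / \<gamma>) *\<^sub>R ((s n - r n) - \<gamma> *\<^sub>R b n)" for n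
    by simp
  then have "a n = (1 / \<gamma>) *\<^sub>R (s n - r n) - b n" for n
    using \<gamma> by (simp add: scaleR_right_diff_distrib)
  then have a_eq: "a = (\<lambda>n. (1 / \<gamma>) *\<^sub>R (s n - r n) - b n)"
    by (rule ext)
  have "(\<lambda>n. (1 / \<gamma>) *\<^sub>R (s n - r n) - b n) \<longlonglongrightarrow> (1 / \<gamma>) *\<^sub>R 0 - c"
    by (intro tendsto_intros gap c)
  then have lim_a: "a \<longlonglongrightarrow> - c"
    unfolding a_eq by simp
  then have "- c \<in> A x"
    by (rule maximal_monotone_closed_graph[OF A a r])
  then show thesis
    using that c p x r lim_a by blast
qed

section \<open>Relaxed projections onto separating half-spaces\<close>

lemma relaxed_projection_decrease:
  fixes u v y z :: "'a::real_inner"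
  assumes sep: "0 \<le> (y - z) \<bullet> v" and cut: "0 \<le> (u - y) \<bullet> v" and v: "v \<noteq> 0" and \<rho>: "0 < \<rho>"
    and u': "u' = u - (\<rho> * ((u - y) \<bullet> v / (norm v)\<^sup>2)) *\<^sub>R v"
  shows "(norm (u' - z))\<^sup>2 \<le> (norm (u - z))\<^sup>2 - (2 - \<rho>) / \<rho> * (norm (u' - u))\<^sup>2"
proof -
  define c where "c = (u - y) \<bullet> v"
  define t where "t = \<rho> * (c / (norm v)\<^sup>2)"
  have u'_eq: "u' = u - t *\<^sub>R v"
    by (simp add: u' t_def c_def)
  have t: "0 \<le> t"
    using cut \<rho> by (simp add: t_def c_def)
  have t2: "t * (v \<bullet> v) = \<rho> * c"
    using v by (simp add: t_def power2_norm_eq_inner)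
  have step: "(norm (u' - u))\<^sup>2 = t * (\<rho> * c)"
    unfolding t2[symmetric] u'_eq power2_norm_eq_inner by simp
  have "(norm (u' - z))\<^sup>2 = (norm (u - z))\<^sup>2 - 2 * t * ((u - z) \<bullet> v) + t * (t * (v \<bullet> v))"
    by (simp add: u'_eq power2_norm_eq_inner algebra_simps inner_commute)
  also have "\<dots> = (norm (u - z))\<^sup>2 - 2 * (t * (c + (y - z) \<bullet> v)) + t * (\<rho> * c)"
    unfolding t2 by (simp add: c_def algebra_simps)
  also have "\<dots> \<le> (norm (u - z))\<^sup>2 - 2 * (t * c) + t * (\<rho> * c)"
    using mult_nonneg_nonneg[OF t sep] by (simp add: algebra_simps)
  also have "\<dots> = (norm (u - z))\<^sup>2 - (2 - \<rho>) / \<rho> * (norm (u' - u))\<^sup>2"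
    unfolding step using \<rho> by (simp add: field_simps)
  finally show ?thesis .
qed

text \<open>
  Expanding \<open>\<parallel>(y - u) + v\<parallel>\<^sup>2\<close> turns the relative error test into a quantitative statement that the
  half-space cuts off \<open>u\<close>.
\<close>

lemma relative_error_inner:
  fixes u v y :: "'a::real_inner"
  assumes "(norm (y + v - u))\<^sup>2 \<le> \<sigma>\<^sup>2 * ((norm (y - u))\<^sup>2 + (norm v)\<^sup>2)"
  shows "(1 - \<sigma>\<^sup>2) / 2 * ((norm (y - u))\<^sup>2 + (norm v)\<^sup>2) \<le> (u - y) \<bullet> v"
proof -
  have "(norm (y + v - u))\<^sup>2 = (norm (y - u))\<^sup>2 + (norm v)\<^sup>2 - 2 * ((u - y) \<bullet> v)"
    by (simp add: power2_norm_eq_inner algebra_simps inner_commute)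
  with assms show ?thesis
    by (simp add: field_simps)
qed

text \<open>
  The step has length \<open>\<rho> ((u - y) \<bullet> v) / \<parallel>v\<parallel>\<close>. Dividing the cut by \<open>\<parallel>v\<parallel>\<close> bounds it below by a
  multiple of \<open>\<parallel>v\<parallel>\<close>; to bound it by \<open>\<parallel>y - u\<parallel>\<close> as well, the product
  \<open>\<parallel>v\<parallel> \<parallel>y - u\<parallel>\<close> is absorbed in the sum of squares.
\<close>

lemma relaxed_projection_long:
  fixes u v y :: "'a::real_inner"
  assumes cut: "\<kappa> * ((norm (y - u))\<^sup>2 + (norm v)\<^sup>2) \<le> (u - y) \<bullet> v" and \<kappa>: "0 \<le> \<kappa>"
    and v: "v \<noteq> 0" and \<rho>: "0 < \<rho>"
    and u': "u' = u - (\<rho> * ((u - y) \<bullet> v / (norm v)\<^sup>2)) *\<^sub>R v"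
  shows "\<rho> * \<kappa> * norm v \<le> norm (u' - u)" "\<rho> * \<kappa> * norm (y - u) \<le> norm (u' - u)"
proof -
  define c where "c = (u - y) \<bullet> v"
  have pos: "0 < norm v"
    using v by simp
  have "0 \<le> c"
    using order_trans[OF mult_nonneg_nonneg cut, OF \<kappa>] by (simp add: c_def)
  then have step: "norm (u' - u) = \<rho> * (c / norm v)"
    using \<rho> pos by (simp add: u' c_def power2_eq_square)
  have young: "norm v * norm (y - u) \<le> (norm (y - u))\<^sup>2 + (norm v)\<^sup>2"
    using sum_squares_bound[of "norm v" "norm (y - u)"] mult_nonneg_nonneg[of "norm v" "norm (y - u)"]
    unfolding mult.assoc by (simp del: mult_nonneg_nonneg)
  have "\<kappa> * (norm v * norm v) \<le> c"
    using order_trans[OF mult_left_mono[OF _ \<kappa>] cut, of "norm v * norm v"]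
    by (simp add: c_def power2_eq_square)
  then have "\<kappa> * norm v \<le> c / norm v"
    using pos by (simp add: field_simps)
  then show "\<rho> * \<kappa> * norm v \<le> norm (u' - u)"
    unfolding step mult.assoc by (rule mult_left_mono[OF _ less_imp_le[OF \<rho>]])
  have "\<kappa> * (norm v * norm (y - u)) \<le> c"
    using order_trans[OF mult_left_mono[OF young \<kappa>] cut] by (simp add: c_def)
  then have "\<kappa> * norm (y - u) \<le> c / norm v"
    using pos by (simp add: field_simps)
  then show "\<rho> * \<kappa> * norm (y - u) \<le> norm (u' - u)"
    unfolding step mult.assoc by (rule mult_left_mono[OF _ less_imp_le[OF \<rho>]])
qed

section \<open>Inertial Fejer-monotone sequences\<close>

lemma perturbed_contraction_null:
  fixes u e :: "nat \<Rightarrow> real"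
  assumes \<alpha>: "0 \<le> \<alpha>" "\<alpha> < 1" and u: "\<And>k. 0 \<le> u k"
    and step: "\<And>k. u (Suc k) \<le> \<alpha> * u k + e k" and e: "e \<longlonglongrightarrow> 0"
  shows "u \<longlonglongrightarrow> 0"
proof (rule LIMSEQ_I)
  fix \<epsilon> :: real assume \<epsilon>: "0 < \<epsilon>"
  then have "0 < (1 - \<alpha>) * (\<epsilon> / 2)"
    using \<alpha> by simp
  from LIMSEQ_D[OF e this] obtain N where N: "\<And>k. N \<le> k \<Longrightarrow> e k < (1 - \<alpha>) * (\<epsilon> / 2)"
    by (metis abs_ge_self diff_zero le_less_trans real_norm_def)
  have decay: "u (N + j) \<le> \<alpha> ^ j * u N + \<epsilon> / 2" for j
  proof (induction j)
    case (Suc j)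
    have "u (N + Suc j) \<le> \<alpha> * u (N + j) + (1 - \<alpha>) * (\<epsilon> / 2)"
      using step[of "N + j"] N[of "N + j"] by simp
    also have "\<dots> \<le> \<alpha> * (\<alpha> ^ j * u N + \<epsilon> / 2) + (1 - \<alpha>) * (\<epsilon> / 2)"
      using mult_left_mono[OF Suc \<alpha>(1)] by simp
    finally show ?case
      by (simp add: field_simps)
  qed (use \<epsilon> in simp)
  have "(\<lambda>j. \<alpha> ^ j * u N) \<longlonglongrightarrow> 0 * u N"
    using \<alpha> by (intro tendsto_intros LIMSEQ_realpow_zero)
  then have "eventually (\<lambda>j. \<alpha> ^ j * u N < \<epsilon> / 2) sequentially"
    using \<epsilon> by (auto dest!: order_tendstoD(2)[where a = "\<epsilon> / 2"])
  then obtain J where J: "\<And>j. J \<le> j \<Longrightarrow> \<alpha> ^ j * u N < \<epsilon> / 2"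
    by (auto simp: eventually_sequentially)
  have "norm (u k - 0) < \<epsilon>" if "N + J \<le> k" for k
  proof -
    from that have "k = N + (k - N)" "J \<le> k - N"
      by auto
    then have "u k < \<epsilon>"
      using decay[of "k - N"] J[of "k - N"] by simp
    then show ?thesis
      using u[of k] by simp
  qed
  then show "\<exists>k0. \<forall>k\<ge>k0. norm (u k - 0) < \<epsilon>"
    by blast
qed

lemma inertial_norm_identity:
  fixes p q z :: "'a::real_inner"
  shows "(norm (p + a *\<^sub>R (p - q) - z))\<^sup>2
    = (1 + a) * (norm (p - z))\<^sup>2 - a * (norm (q - z))\<^sup>2 + a * (1 + a) * (norm (p - q))\<^sup>2"
  by (simp add: power2_norm_eq_inner algebra_simps inner_commute)

lemma inertial_step_lower_bound:
  fixes d d' :: "'a::real_inner"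
  assumes "0 \<le> a"
  shows "(1 - a) * (norm d')\<^sup>2 - a * (1 - a) * (norm d)\<^sup>2 \<le> (norm (d' - a *\<^sub>R d))\<^sup>2"
proof -
  have "(norm (d' - a *\<^sub>R d))\<^sup>2 - ((1 - a) * (norm d')\<^sup>2 - a * (1 - a) * (norm d)\<^sup>2)
      = a * (norm (d' - d))\<^sup>2"
    by (simp add: power2_norm_eq_inner algebra_simps inner_commute)
  moreover have "0 \<le> a * (norm (d' - d))\<^sup>2"
    using assms by simp
  ultimately show ?thesis
    by linarith
qed

text \<open>
  The step \<open>k\<close> starts from the extrapolated point \<open>w k\<close>; truncated subtraction makes the first step
  inertia-free. The set \<open>Z\<close> collects the targets to which the method gets closer.
\<close>

locale inertial_fejer =
  fixes p w :: "nat \<Rightarrow> 'a::real_inner" and a :: "nat \<Rightarrow> real" and \<alpha> \<eta> :: real and Z :: "'a set"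
  assumes w: "\<And>k. w k = p k + a k *\<^sub>R (p k - p (k - 1))"
    and a_nonneg: "\<And>k. 0 \<le> a k" and a_le: "\<And>k. a k \<le> \<alpha>"
    and a_mono: "\<And>k. a k \<le> a (Suc k)"
    and \<alpha>_less: "\<alpha> < 1" and \<eta>_large: "\<alpha> * (1 + \<alpha>) < \<eta> * (1 - \<alpha>)\<^sup>2"
    and fejer: "\<And>z k. z \<in> Z \<Longrightarrow>
      (norm (p (Suc k) - z))\<^sup>2 \<le> (norm (w k - z))\<^sup>2 - \<eta> * (norm (p (Suc k) - w k))\<^sup>2"
begin

lemma \<alpha>_nonneg: "0 \<le> \<alpha>"
  using a_nonneg a_le order_trans by blast

lemma \<eta>_pos: "0 < \<eta>"
proof -
  have "0 \<le> \<alpha> * (1 + \<alpha>)"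
    using \<alpha>_nonneg by simp
  then have "0 < \<eta> * (1 - \<alpha>)\<^sup>2"
    using \<eta>_large by linarith
  then show ?thesis
    by (simp add: zero_less_mult_iff)
qed

abbreviation displacement :: "nat \<Rightarrow> real" where
  "displacement k \<equiv> (norm (p k - p (k - 1)))\<^sup>2"

text \<open>
  The weight of the displacement is exactly its coefficient in the one-step estimate of the squared
  distance, so that these terms telescope.
\<close>

definition energy :: "'a \<Rightarrow> nat \<Rightarrow> real" where
  "energy z k = (norm (p k - z))\<^sup>2 - a k * (norm (p (k - 1) - z))\<^sup>2
     + (a k * (1 + a k) + \<eta> * a k * (1 - a k)) * displacement k"

abbreviation decay_rate :: real where
  "decay_rate \<equiv> \<eta> * (1 - \<alpha>)\<^sup>2 - \<alpha> * (1 + \<alpha>)"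

lemma decay_rate_pos: "0 < decay_rate"
  using \<eta>_large by simp

text \<open>
  Monotonicity of the inertial parameters enters twice: it lets the old coefficient of the squared
  distance be replaced by the new one, and \<open>1 - a k\<close> by \<open>1 - a (Suc k)\<close>. What remains
  of the displacement has coefficient \<open>\<eta> (1 - t)\<^sup>2 - t (1 + t)\<close> at \<open>t = a (Suc k)\<close>, which is
  decreasing in \<open>t\<close>.
\<close>

lemma energy_decrease:
  assumes z: "z \<in> Z"
  shows "energy z (Suc k) + decay_rate * displacement (Suc k) \<le> energy z k"
proof -
  define t where "t = a (Suc k)"
  define c where "c = a k"
  define \<phi> where "\<phi> j = (norm (p j - z))\<^sup>2" for j
  define \<delta> where "\<delta> = displacement k"
  define \<delta>' where "\<delta>' = displacement (Suc k)"
  have t: "0 \<le> t" "t \<le> \<alpha>" "t < 1" "c \<le> t" "0 \<le> c"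
    using a_nonneg a_le[of "Suc k"] \<alpha>_less a_mono[of k] by (auto simp: t_def c_def)
  have nonneg: "0 \<le> \<phi> k" "0 \<le> \<delta>" "0 \<le> \<delta>'"
    by (simp_all add: \<phi>_def \<delta>_def \<delta>'_def)
  have "p (Suc k) - w k = (p (Suc k) - p (Suc k - 1)) - c *\<^sub>R (p k - p (k - 1))"
    by (simp add: w c_def algebra_simps)
  then have "(1 - c) * \<delta>' - c * (1 - c) * \<delta> \<le> (norm (p (Suc k) - w k))\<^sup>2"
    using inertial_step_lower_bound[OF t(5), of "p (Suc k) - p (Suc k - 1)" "p k - p (k - 1)"]
    by (simp only: \<delta>_def \<delta>'_def)
  then have "\<eta> * ((1 - c) * \<delta>' - c * (1 - c) * \<delta>) \<le> \<eta> * (norm (p (Suc k) - w k))\<^sup>2"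
    using \<eta>_pos by simp
  moreover have "(norm (w k - z))\<^sup>2 = (1 + c) * \<phi> k - c * \<phi> (k - 1) + c * (1 + c) * \<delta>"
    unfolding w inertial_norm_identity by (simp add: c_def \<phi>_def \<delta>_def)
  ultimately have one_step: "\<phi> (Suc k) \<le> (1 + c) * \<phi> k - c * \<phi> (k - 1) + c * (1 + c) * \<delta>
      - \<eta> * ((1 - c) * \<delta>' - c * (1 - c) * \<delta>)"
    using fejer[OF z, of k] by (simp add: \<phi>_def)
  have "c * \<phi> k \<le> t * \<phi> k"
    using t nonneg by (simp add: mult_right_mono)
  moreover have "\<eta> * (1 - t) * \<delta>' \<le> \<eta> * (1 - c) * \<delta>'"
    using t nonneg \<eta>_pos by (intro mult_right_mono mult_left_mono) auto
  moreover have "decay_rate * \<delta>' \<le> (\<eta> * (1 - t)\<^sup>2 - t * (1 + t)) * \<delta>'"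
  proof (intro mult_right_mono diff_mono mult_left_mono power_mono mult_mono)
  qed (use t \<alpha>_less \<eta>_pos nonneg in auto)
  moreover have "(\<eta> * (1 - t)\<^sup>2 - t * (1 + t)) * \<delta>'
      = \<eta> * (1 - t) * \<delta>' - (t * (1 + t) + \<eta> * t * (1 - t)) * \<delta>'"
    by (simp add: power2_eq_square algebra_simps)
  moreover have "energy z (Suc k) = \<phi> (Suc k) - t * \<phi> k + (t * (1 + t) + \<eta> * t * (1 - t)) * \<delta>'"
    by (simp add: energy_def t_def \<phi>_def \<delta>'_def)
  moreover have "energy z k = \<phi> k - c * \<phi> (k - 1) + (c * (1 + c) + \<eta> * c * (1 - c)) * \<delta>"
    by (simp add: energy_def c_def \<phi>_def \<delta>_def)
  ultimately show ?thesis
    using one_step unfolding \<delta>'_def[symmetric] by (simp add: algebra_simps)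
qed

lemma energy_decseq:
  assumes "z \<in> Z"
  shows "decseq (energy z)"
proof (rule decseq_SucI)
  show "energy z (Suc k) \<le> energy z k" for k
    using energy_decrease[OF assms, of k]
      mult_nonneg_nonneg[OF less_imp_le[OF decay_rate_pos], of "displacement (Suc k)"] by simp
qed

lemma energy_ge:
  "(norm (p k - z))\<^sup>2 - a k * (norm (p (k - 1) - z))\<^sup>2 \<le> energy z k"
proof -
  have "a k \<le> 1"
    using a_le[of k] \<alpha>_less by simp
  then show ?thesis
    using a_nonneg[of k] \<eta>_pos by (simp add: energy_def)
qed

text \<open>
  The first energy is at most the first squared distance, and since energies decrease, the squared
  distances satisfy \<open>\<phi> (Suc k) \<le> \<alpha> \<phi> k + \<phi> 0\<close>; the bound is the fixed point of this recursion.
\<close>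

lemma distance_bound:
  assumes z: "z \<in> Z"
  shows "(norm (p k - z))\<^sup>2 \<le> (norm (p 0 - z))\<^sup>2 / (1 - \<alpha>)"
proof (induction k)
  case 0
  have "(1 - \<alpha>) * (norm (p 0 - z))\<^sup>2 \<le> 1 * (norm (p 0 - z))\<^sup>2"
    using \<alpha>_nonneg by (intro mult_right_mono) auto
  then show ?case
    using \<alpha>_less by (simp add: field_simps)
next
  case (Suc k)
  have "(norm (p (Suc k) - z))\<^sup>2 \<le> a (Suc k) * (norm (p k - z))\<^sup>2 + energy z (Suc k)"
    using energy_ge[of "Suc k" z] by simp
  also have "energy z (Suc k) \<le> energy z 0"
    using energy_decseq[OF z] by (simp add: decseq_def)
  also have "energy z 0 \<le> (norm (p 0 - z))\<^sup>2"
    using a_nonneg[of 0] by (simp add: energy_def)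
  also have "a (Suc k) * (norm (p k - z))\<^sup>2 \<le> \<alpha> * ((norm (p 0 - z))\<^sup>2 / (1 - \<alpha>))"
    using a_le \<alpha>_nonneg Suc by (intro mult_mono) auto
  also have "\<alpha> * ((norm (p 0 - z))\<^sup>2 / (1 - \<alpha>)) + (norm (p 0 - z))\<^sup>2
      = (norm (p 0 - z))\<^sup>2 / (1 - \<alpha>)"
    using \<alpha>_less by (simp add: field_simps)
  finally show ?case
    by simp
qed

lemma bounded_iterates:
  assumes z: "z \<in> Z"
  shows "bounded (range p)"
proof -
  have "dist z (p k) \<le> sqrt ((norm (p 0 - z))\<^sup>2 / (1 - \<alpha>))" for k
    using real_le_rsqrt[OF distance_bound[OF z, of k]] by (simp add: dist_norm norm_minus_commute)
  then show ?thesis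
    unfolding bounded_def by blast
qed

lemma energy_convergent:
  assumes z: "z \<in> Z"
  shows "convergent (energy z)"
proof -
  define M where "M = (norm (p 0 - z))\<^sup>2 / (1 - \<alpha>)"
  have "- M \<le> energy z k" for k
  proof -
    have "a k * (norm (p (k - 1) - z))\<^sup>2 \<le> 1 * M"
      using a_le[of k] \<alpha>_less distance_bound[OF z, of "k - 1"]
      unfolding M_def[symmetric] by (intro mult_mono) auto
    then show ?thesis
      using energy_ge[of k z] zero_le_power2[of "norm (p k - z)"] by linarith
  qed
  then show ?thesis
    using decseq_convergent[OF energy_decseq[OF z]] by (metis convergentI)
qed

lemma displacement_null:
  assumes z: "z \<in> Z"
  shows "displacement \<longlonglongrightarrow> 0"
proof -
  obtain L where L: "energy z \<longlonglongrightarrow> L"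
    using energy_convergent[OF z] by (auto simp: convergent_def)
  have "(\<lambda>k. (energy z k - energy z (Suc k)) / decay_rate) \<longlonglongrightarrow> (L - L) / decay_rate"
    using decay_rate_pos by (intro tendsto_intros L LIMSEQ_Suc) auto
  then have upper: "(\<lambda>k. (energy z k - energy z (Suc k)) / decay_rate) \<longlonglongrightarrow> 0"
    by simp
  have "(\<lambda>k. displacement (Suc k)) \<longlonglongrightarrow> 0"
  proof (rule tendsto_sandwich[OF _ _ tendsto_const upper])
    show "eventually (\<lambda>k. 0 \<le> displacement (Suc k)) sequentially"
      by simp
    show "eventually (\<lambda>k. displacement (Suc k) \<le> (energy z k - energy z (Suc k)) / decay_rate)
        sequentially"
      using energy_decrease[OF z] decay_rate_pos
      by (intro always_eventually allI) (simp add: pos_le_divide_eq algebra_simps)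
  qed
  then show ?thesis
    by (rule LIMSEQ_imp_Suc)
qed

lemma difference_null:
  assumes z: "z \<in> Z"
  shows "(\<lambda>k. p k - p (k - 1)) \<longlonglongrightarrow> 0"
proof (rule tendsto_norm_zero_cancel)
  show "(\<lambda>k. norm (p k - p (k - 1))) \<longlonglongrightarrow> 0"
    using tendsto_real_sqrt[OF displacement_null[OF z]]
    unfolding real_sqrt_abs abs_norm_cancel real_sqrt_zero .
qed

lemma inertial_term_null:
  assumes z: "z \<in> Z"
  shows "(\<lambda>k. a k *\<^sub>R (p k - p (k - 1))) \<longlonglongrightarrow> 0"
proof (rule Lim_null_comparison[OF _ tendsto_norm_zero[OF difference_null[OF z]]])
  show "eventually (\<lambda>k. norm (a k *\<^sub>R (p k - p (k - 1))) \<le> norm (p k - p (k - 1))) sequentially"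
  proof (intro always_eventually allI)
    fix k
    have "\<bar>a k\<bar> \<le> 1"
      using a_nonneg[of k] a_le[of k] \<alpha>_less by simp
    then show "norm (a k *\<^sub>R (p k - p (k - 1))) \<le> norm (p k - p (k - 1))"
      by (simp add: mult_left_le_one_le)
  qed
qed

lemma step_null:
  assumes z: "z \<in> Z"
  shows "(\<lambda>k. p (Suc k) - w k) \<longlonglongrightarrow> 0"
  using tendsto_diff[OF LIMSEQ_Suc[OF difference_null[OF z]] inertial_term_null[OF z]]
  by (simp add: w diff_diff_eq)

text \<open>
  For a target \<open>z\<close>, the difference of \<open>\<parallel>p k - z\<parallel>\<^sup>2\<close> and \<open>a k\<close> times its predecessor has
  a limit, because the energy has one. If \<open>z\<close> is itself a cluster point, that limit is \<open>0\<close>, so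
  the squared distances obey a contraction up to a null sequence.
\<close>

lemma cluster_point_is_limit:
  assumes z: "z \<in> Z" and f: "strict_mono f" and cluster: "(p \<circ> f) \<longlonglongrightarrow> z"
  shows "p \<longlonglongrightarrow> z"
proof -
  define \<phi> where "\<phi> k = (norm (p k - z))\<^sup>2" for k
  define \<psi> where "\<psi> k = \<phi> k - a k * \<phi> (k - 1)" for k
  define c where "c k = a k * (1 + a k) + \<eta> * a k * (1 - a k)" for k
  have a01: "0 \<le> a k" "a k \<le> 1" for k
    using a_nonneg[of k] a_le[of k] \<alpha>_less by auto
  obtain L where L: "energy z \<longlonglongrightarrow> L"
    using energy_convergent[OF z] by (auto simp: convergent_def)
  have "(\<lambda>k. c k * displacement k) \<longlonglongrightarrow> 0"
  proof (rule Lim_null_comparison)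
    show "(\<lambda>k. (2 + \<eta>) * displacement k) \<longlonglongrightarrow> 0"
      using tendsto_mult_left[OF displacement_null[OF z], of "2 + \<eta>"] by simp
    show "eventually (\<lambda>k. norm (c k * displacement k) \<le> (2 + \<eta>) * displacement k) sequentially"
    proof (intro always_eventually allI)
      fix k
      have "a k * (1 + a k) \<le> 1 * 2" "a k * (1 - a k) \<le> 1 * 1"
        using a01[of k] by (intro mult_mono; simp)+
      then have "c k \<le> 2 + \<eta>"
        using \<eta>_pos mult_left_mono[of "a k * (1 - a k)" 1 \<eta>] unfolding c_def mult.assoc by linarith
      moreover have "0 \<le> c k"
        using a01[of k] \<eta>_pos by (simp add: c_def)
      ultimately show "norm (c k * displacement k) \<le> (2 + \<eta>) * displacement k"
        by (simp add: abs_mult mult_right_mono)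
    qed
  qed
  from tendsto_diff[OF L this] have \<psi>_lim: "\<psi> \<longlonglongrightarrow> L"
    by (simp add: \<psi>_def[abs_def] \<phi>_def energy_def[abs_def] c_def)
  have "L = 0"
  proof (rule LIMSEQ_unique)
    show "(\<lambda>j. \<psi> (f j)) \<longlonglongrightarrow> L"
      using LIMSEQ_subseq_LIMSEQ[OF \<psi>_lim f] by (simp add: o_def)
    have p_f: "(\<lambda>j. p (f j)) \<longlonglongrightarrow> z"
      using cluster by (simp add: o_def)
    have "(\<lambda>j. p (f j) - p (f j - 1)) \<longlonglongrightarrow> 0"
      using LIMSEQ_subseq_LIMSEQ[OF difference_null[OF z] f] by (simp add: o_def)
    from tendsto_diff[OF p_f this] have p_pred: "(\<lambda>j. p (f j - 1)) \<longlonglongrightarrow> z"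
      by simp
    have "(\<lambda>j. \<phi> (f j) + \<phi> (f j - 1)) \<longlonglongrightarrow> (norm (z - z))\<^sup>2 + (norm (z - z))\<^sup>2"
      unfolding \<phi>_def by (intro tendsto_intros p_f p_pred)
    then have bound: "(\<lambda>j. \<phi> (f j) + \<phi> (f j - 1)) \<longlonglongrightarrow> 0"
      by simp
    show "(\<lambda>j. \<psi> (f j)) \<longlonglongrightarrow> 0"
    proof (rule Lim_null_comparison[OF _ bound])
      show "eventually (\<lambda>j. norm (\<psi> (f j)) \<le> \<phi> (f j) + \<phi> (f j - 1)) sequentially"
      proof (intro always_eventually allI)
        fix j
        have "0 \<le> \<phi> (f j)" "0 \<le> \<phi> (f j - 1)"
          by (simp_all add: \<phi>_def)
        moreover from this have "0 \<le> a (f j) * \<phi> (f j - 1)" "a (f j) * \<phi> (f j - 1) \<le> \<phi> (f j - 1)"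
          using a01[of "f j"] by (simp_all add: mult_left_le_one_le)
        ultimately show "norm (\<psi> (f j)) \<le> \<phi> (f j) + \<phi> (f j - 1)"
          by (simp add: \<psi>_def)
      qed
    qed
  qed
  have "\<phi> \<longlonglongrightarrow> 0"
  proof (rule perturbed_contraction_null[OF \<alpha>_nonneg \<alpha>_less])
    show "0 \<le> \<phi> k" for k
      by (simp add: \<phi>_def)
    then show "\<phi> (Suc k) \<le> \<alpha> * \<phi> k + \<psi> (Suc k)" for k
      using mult_right_mono[OF a_le[of "Suc k"], of "\<phi> k"] by (simp add: \<psi>_def)
    show "(\<lambda>k. \<psi> (Suc k)) \<longlonglongrightarrow> 0"
      using LIMSEQ_Suc[OF \<psi>_lim] \<open>L = 0\<close> by simp
  qed
  from tendsto_real_sqrt[OF this] have "(\<lambda>k. norm (p k - z)) \<longlonglongrightarrow> 0"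
    by (simp add: \<phi>_def)
  then show ?thesis
    by (simp add: LIM_zero_iff tendsto_norm_zero_iff)
qed

end

lemma inertial_fejer_converges:
  fixes p :: "nat \<Rightarrow> 'a::euclidean_space"
  assumes "inertial_fejer p w a \<alpha> \<eta> Z" and "Z \<noteq> {}"
    and cluster: "\<And>f z. strict_mono f \<Longrightarrow> (p \<circ> f) \<longlonglongrightarrow> z \<Longrightarrow> z \<in> Z"
  obtains z where "z \<in> Z" "p \<longlonglongrightarrow> z"
proof -
  interpret inertial_fejer p w a \<alpha> \<eta> Z
    by fact
  have "bounded (range p)"
    using bounded_iterates \<open>Z \<noteq> {}\<close> by blast
  then obtain z f where f: "strict_mono f" "(p \<circ> f) \<longlonglongrightarrow> z"
    using bounded_imp_convergent_subsequence by blast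
  from cluster[OF f] have "z \<in> Z" .
  then show thesis
    using that cluster_point_is_limit f by blast
qed

section \<open>The executions of the algorithm\<close>

text \<open>
  At \<open>\<alpha> = \<beta>\<close> the value of \<open>\<eta> = (2 - \<rho>) / \<rho>\<close> that belongs to the prescribed bound \<open>\<rho>\<close> would turn
  the strict inequality into an equality.
\<close>

lemma relaxation_bound_admissible:
  fixes \<alpha> \<beta> \<rho> :: real
  assumes "0 \<le> \<alpha>" "\<alpha> < \<beta>" "\<beta> < 1"
    and \<rho>: "\<rho> = 2 * (\<beta> - 1)\<^sup>2 / (2 * (\<beta> - 1)\<^sup>2 + 3 * \<beta> - 1)"
  shows "\<alpha> * (1 + \<alpha>) < (2 - \<rho>) / \<rho> * (1 - \<alpha>)\<^sup>2"
proof -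
  have num: "0 < (\<beta> - 1)\<^sup>2"
    using assms by simp
  define D where "D = (\<beta> - 1)\<^sup>2 + \<beta> * (1 + \<beta>)"
  have "0 \<le> \<beta> * (1 + \<beta>)"
    using assms by simp
  then have D: "0 < D"
    unfolding D_def using num by linarith
  have "2 * (\<beta> - 1)\<^sup>2 + 3 * \<beta> - 1 = D"
    by (simp add: D_def power2_eq_square algebra_simps)
  then have "\<rho> = 2 * (\<beta> - 1)\<^sup>2 / D"
    unfolding \<rho> by simp
  then have "(2 - \<rho>) / \<rho> = (D - (\<beta> - 1)\<^sup>2) / (\<beta> - 1)\<^sup>2"
    using D num by (simp add: frac_eq_eq) (simp add: field_simps)
  then have \<eta>: "(2 - \<rho>) / \<rho> = \<beta> * (1 + \<beta>) / (\<beta> - 1)\<^sup>2"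
    by (simp add: D_def)
  have "\<alpha> * (1 + \<alpha>) < \<beta> * (1 + \<beta>)"
    using assms by (intro mult_strict_mono) auto
  also have "\<dots> = \<beta> * (1 + \<beta>) / (\<beta> - 1)\<^sup>2 * (1 - \<beta>)\<^sup>2"
    using num by (simp add: power2_commute[of 1 \<beta>])
  also have "\<dots> \<le> \<beta> * (1 + \<beta>) / (\<beta> - 1)\<^sup>2 * (1 - \<alpha>)\<^sup>2"
    using assms by (intro mult_left_mono power_mono) auto
  finally show ?thesis
    unfolding \<eta> .
qed

lemma B_procedureD:
  assumes "B_procedure B P" "0 < \<gamma>"
  shows "1 \<le> l \<Longrightarrow> snd (P r b \<gamma> s' b' l) \<in> B (fst (P r b \<gamma> s' b' l))"
    and "(\<lambda>l. fst (P r b \<gamma> s' b' l) + \<gamma> *\<^sub>R snd (P r b \<gamma> s' b' l)) \<longlonglongrightarrow> r + \<gamma> *\<^sub>R b"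
  using assms unfolding B_procedure_def by blast+

lemma inner_stepD:
  assumes "inner_step A P \<gamma> E k l"
  shows "P (hat_r E k) (hat_b E k) \<gamma> (hat_s E k) (hat_b E k) l = (in_s E k l, in_b E k l)"
    and "in_a E k l \<in> A (in_r E k l)"
    and "in_r E k l + \<gamma> *\<^sub>R in_a E k l = in_s E k l - \<gamma> *\<^sub>R in_b E k l"
  using assms unfolding inner_step_def by auto

lemma inner_step_B:
  assumes "B_procedure B P" "0 < \<gamma>" "1 \<le> l" "inner_step A P \<gamma> E k l"
  shows "in_b E k l \<in> B (in_s E k l)"
  using B_procedureD(1)[OF assms(1-3), of "hat_r E k" "hat_b E k" "hat_s E k" "hat_b E k"]
    inner_stepD(1)[OF assms(4)] by simp

lemma stopped_execution_solves:
  assumes P: "B_procedure B P" and \<gamma>: "0 < \<gamma>"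
    and stop: "stops_at A P \<gamma> \<alpha> \<sigma> \<rho>lo \<rho>hi E K"
  shows "0 \<in> A (in_s E K (ell E K)) + B (in_s E K (ell E K))"
proof -
  have l: "1 \<le> ell E K" and step: "inner_step A P \<gamma> E K (ell E K)"
    and eq: "in_s E K (ell E K) = in_r E K (ell E K)"
    using stop by (auto simp: stops_at_def inner_loop_finite_def)
  have "\<gamma> *\<^sub>R (in_a E K (ell E K) + in_b E K (ell E K)) = 0"
    using inner_stepD(3)[OF step] eq by (simp add: algebra_simps)
  then have "in_a E K (ell E K) = - in_b E K (ell E K)"
    using \<gamma> by (simp add: eq_neg_iff_add_eq_0)
  then have "- in_b E K (ell E K) \<in> A (in_s E K (ell E K))"
    using inner_stepD(2)[OF step] eq by simp
  then show ?thesis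
    by (rule zero_in_set_sumI[OF inner_step_B[OF P \<gamma> l step]])
qed

text \<open>
  The left-hand side of the failing test tends to \<open>0\<close> by the defining property of the procedure,
  and \<open>\<sigma> > 0\<close> transfers this to the gap \<open>s - r\<close>.
\<close>

lemma stuck_execution_converges:
  fixes A B :: "'a::{real_inner, complete_space} \<Rightarrow> 'a set"
  assumes A: "maximal_monotone A" and B: "maximal_monotone B"
    and P: "B_procedure B P" and \<gamma>: "0 < \<gamma>" and \<sigma>: "0 < \<sigma>"
    and stuck: "inner_loop_stuck_at A P \<gamma> \<alpha> \<sigma> \<rho>lo \<rho>hi E K"
  shows "\<exists>x b. 0 \<in> A x + B x \<and> b \<in> B x \<and> - b \<in> A x \<and>
    in_s E K \<longlonglongrightarrow> x \<and> in_r E K \<longlonglongrightarrow> x \<and> in_b E K \<longlonglongrightarrow> b \<and> in_a E K \<longlonglongrightarrow> - b"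
proof -
  define p where "p = hat_r E K + \<gamma> *\<^sub>R hat_b E K"
  \<comment> \<open>Inner indices start at \<open>1\<close>.\<close>
  define s r a b where "s l = in_s E K (Suc l)" and "r l = in_r E K (Suc l)"
    and "a l = in_a E K (Suc l)" and "b l = in_b E K (Suc l)" for l
  note defs = s_def r_def a_def b_def
  have step: "inner_step A P \<gamma> E K (Suc l)" and fail: "\<not> inner_test \<gamma> \<sigma> E K (Suc l)" for l
    using stuck by (auto simp: inner_loop_stuck_at_def inner_loop_infinite_def)
  have lim: "(\<lambda>l. s l + \<gamma> *\<^sub>R b l) \<longlonglongrightarrow> p"
    using LIMSEQ_Suc[OF B_procedureD(2)[OF P \<gamma>, of "hat_r E K" "hat_b E K" "hat_s E K" "hat_b E K"]]
    by (simp add: inner_stepD(1)[OF step] p_def defs)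
  have gap: "(\<lambda>l. s l - r l) \<longlonglongrightarrow> 0"
  proof (rule Lim_null_comparison)
    show "(\<lambda>l. norm (s l + \<gamma> *\<^sub>R b l - p) / \<sigma>) \<longlonglongrightarrow> 0"
      using tendsto_divide[OF tendsto_norm_zero[OF LIM_zero[OF lim]] tendsto_const, of \<sigma>] \<sigma> by simp
    show "eventually (\<lambda>l. norm (s l - r l) \<le> norm (s l + \<gamma> *\<^sub>R b l - p) / \<sigma>) sequentially"
    proof (intro always_eventually allI)
      fix l
      have "\<sigma>\<^sup>2 * (norm (s l - r l))\<^sup>2
          \<le> \<sigma>\<^sup>2 * ((norm (r l + \<gamma> *\<^sub>R b l - p))\<^sup>2 + (norm (s l - r l))\<^sup>2)"
        by (intro mult_left_mono) auto
      also have "\<dots> \<le> (norm (s l + \<gamma> *\<^sub>R b l - p))\<^sup>2"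
        using fail[of l] by (simp add: inner_test_def p_def defs)
      finally have "(\<sigma> * norm (s l - r l))\<^sup>2 \<le> (norm (s l + \<gamma> *\<^sub>R b l - p))\<^sup>2"
        unfolding power_mult_distrib .
      then have "\<sigma> * norm (s l - r l) \<le> norm (s l + \<gamma> *\<^sub>R b l - p)"
        by (rule power2_le_imp_le) simp
      then show "norm (s l - r l) \<le> norm (s l + \<gamma> *\<^sub>R b l - p) / \<sigma>"
        using \<sigma> by (simp add: field_simps)
    qed
  qed
  have mem: "a l \<in> A (r l)" "b l \<in> B (s l)" "r l + \<gamma> *\<^sub>R a l = s l - \<gamma> *\<^sub>R b l" for l
    using inner_stepD(2,3)[OF step] inner_step_B[OF P \<gamma> _ step] by (simp_all add: defs)
  obtain x c where "c \<in> B x" "- c \<in> A x"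
    "s \<longlonglongrightarrow> x" "r \<longlonglongrightarrow> x" "b \<longlonglongrightarrow> c" "a \<longlonglongrightarrow> - c"
    by (rule splitting_limit[OF A B \<gamma> mem lim gap])
  moreover from this have "in_s E K \<longlonglongrightarrow> x" "in_r E K \<longlonglongrightarrow> x" "in_b E K \<longlonglongrightarrow> c" "in_a E K \<longlonglongrightarrow> - c"
    unfolding defs by (auto intro: LIMSEQ_imp_Suc)
  ultimately show ?thesis
    using zero_in_set_sumI[of c "B x" "A x"] by blast
qed

text \<open>
  The outer iteration as a relaxed projection: \<open>\<theta>\<close> is the projection coefficient, and solving the
  update for \<open>r + \<gamma> b\<close> cancels everything but a multiple of \<open>s - r\<close>.
\<close>

lemma update_step_projection:
  assumes \<gamma>: "0 < \<gamma>" and upd: "update_step \<gamma> \<rho>lo \<rho>hi E k"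
  shows "out_r E (Suc k) + \<gamma> *\<^sub>R out_b E (Suc k)
    = (hat_r E k + \<gamma> *\<^sub>R hat_b E k) - (relax E k *
        (((hat_r E k + \<gamma> *\<^sub>R hat_b E k) - (in_r E k (ell E k) + \<gamma> *\<^sub>R in_b E k (ell E k)))
            \<bullet> (in_s E k (ell E k) - in_r E k (ell E k))
          / (norm (in_s E k (ell E k) - in_r E k (ell E k)))\<^sup>2))
      *\<^sub>R (in_s E k (ell E k) - in_r E k (ell E k))"
proof -
  have \<theta>: "theta E (Suc k)
      = ((hat_r E k + \<gamma> *\<^sub>R hat_b E k) - (in_r E k (ell E k) + \<gamma> *\<^sub>R in_b E k (ell E k)))
            \<bullet> (in_s E k (ell E k) - in_r E k (ell E k))
          / (norm (in_s E k (ell E k) - in_r E k (ell E k)))\<^sup>2"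
    using upd by (simp add: update_step_def algebra_simps)
  have "out_b E (Suc k) = hat_b E k - (1 / \<gamma>) *\<^sub>R
       ((1 - relax E k * theta E (Suc k)) *\<^sub>R out_r E (Suc k)
        + (relax E k * theta E (Suc k)) *\<^sub>R out_s E (Suc k) - hat_r E k)"
    using upd by (simp only: update_step_def)
  then have "\<gamma> *\<^sub>R out_b E (Suc k) = \<gamma> *\<^sub>R hat_b E k
      - ((1 - relax E k * theta E (Suc k)) *\<^sub>R out_r E (Suc k)
        + (relax E k * theta E (Suc k)) *\<^sub>R out_s E (Suc k) - hat_r E k)"
    using \<gamma> by (simp add: scaleR_right_diff_distrib)
  moreover have "out_r E (Suc k) = in_r E k (ell E k)" "out_s E (Suc k) = in_s E k (ell E k)"
    using upd by (simp_all add: update_step_def)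
  ultimately show ?thesis
    unfolding \<theta>[symmetric] by (simp add: algebra_simps)
qed

lemma infinite_execution_converges:
  fixes A B :: "'a::euclidean_space \<Rightarrow> 'a set"
  assumes A: "maximal_monotone A" and B: "maximal_monotone B"
    and solvable: "{x. 0 \<in> A x + B x} \<noteq> {}"
    and P: "B_procedure B P" and \<gamma>: "0 < \<gamma>" and \<alpha>: "\<alpha> < 1" and \<sigma>: "0 \<le> \<sigma>" "\<sigma> < 1"
    and \<rho>: "0 < \<rho>lo"
    and inertia_mono: "\<And>k. inertia E k \<le> inertia E (Suc k)"
    and admissible: "\<alpha> * (1 + \<alpha>) < (2 - \<rho>hi) / \<rho>hi * (1 - \<alpha>)\<^sup>2"
    and run: "runs_forever A P \<gamma> \<alpha> \<sigma> \<rho>lo \<rho>hi E"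
  shows "\<exists>x b. 0 \<in> A x + B x \<and> b \<in> B x \<and> - b \<in> A x \<and>
    out_s E \<longlonglongrightarrow> x \<and> out_r E \<longlonglongrightarrow> x \<and>
    (\<lambda>k. in_b E k (ell E k)) \<longlonglongrightarrow> b \<and> out_b E \<longlonglongrightarrow> b \<and>
    (\<lambda>k. in_a E k (ell E k)) \<longlonglongrightarrow> - b"
proof -
  define s r a b where "s k = in_s E k (ell E k)" and "r k = in_r E k (ell E k)"
    and "a k = in_a E k (ell E k)" and "b k = in_b E k (ell E k)" for k
  define p where "p k = out_r E k + \<gamma> *\<^sub>R out_b E k" for k
  define w where "w k = hat_r E k + \<gamma> *\<^sub>R hat_b E k" for k
  define y where "y k = r k + \<gamma> *\<^sub>R b k" for k
  define v where "v k = s k - r k" for k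
  define Z where "Z = splitting_zeros A B \<gamma>"
  define \<eta> where "\<eta> = (2 - \<rho>hi) / \<rho>hi"
  define \<kappa> where "\<kappa> = (1 - \<sigma>\<^sup>2) / 2"
  note defs = s_def r_def a_def b_def

  have pass: "full_pass A P \<gamma> \<alpha> \<sigma> \<rho>lo \<rho>hi E k" for k
    using run by (simp add: runs_forever_def)
  have extra: "extrapolation_step \<alpha> E k" and l: "1 \<le> ell E k"
    and step: "inner_step A P \<gamma> E k (ell E k)" and test: "inner_test \<gamma> \<sigma> E k (ell E k)"
    and v_nonzero: "v k \<noteq> 0" and upd: "update_step \<gamma> \<rho>lo \<rho>hi E k" for k
    using pass[of k] by (auto simp: full_pass_def inner_loop_finite_def v_def defs)
  have relax: "\<rho>lo \<le> relax E k" "relax E k \<le> \<rho>hi" for k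
    using upd[of k] by (auto simp: update_step_def)
  then have relax_pos: "0 < relax E k" for k
    using \<rho> less_le_trans by blast
  have memA: "a k \<in> A (r k)" and memB: "b k \<in> B (s k)"
    and res: "r k + \<gamma> *\<^sub>R a k = s k - \<gamma> *\<^sub>R b k" for k
    using inner_stepD(2,3)[OF step] inner_step_B[OF P \<gamma> l step] by (simp_all add: defs)
  have out: "out_s E (Suc k) = s k" "out_r E (Suc k) = r k" for k
    using upd[of k] by (simp_all add: update_step_def defs)
  have sum_eq: "s k + \<gamma> *\<^sub>R b k = y k + v k" for k
    by (simp add: y_def v_def)

  have \<kappa>: "0 < \<kappa>"
    using power_strict_mono[of \<sigma> 1 2] \<sigma> by (simp add: \<kappa>_def)
  have cut: "\<kappa> * ((norm (y k - w k))\<^sup>2 + (norm (v k))\<^sup>2) \<le> (w k - y k) \<bullet> v k" for k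
    unfolding \<kappa>_def
  proof (rule relative_error_inner)
    show "(norm (y k + v k - w k))\<^sup>2 \<le> \<sigma>\<^sup>2 * ((norm (y k - w k))\<^sup>2 + (norm (v k))\<^sup>2)"
      using test[of k] unfolding sum_eq[symmetric] unfolding inner_test_def y_def v_def w_def defs .
  qed
  have cut_nonneg: "0 \<le> (w k - y k) \<bullet> v k" for k
    using order_trans[OF mult_nonneg_nonneg cut, of k] \<kappa> by simp
  have proj: "p (Suc k) = w k - (relax E k * ((w k - y k) \<bullet> v k / (norm (v k))\<^sup>2)) *\<^sub>R v k" for k
    using update_step_projection[OF \<gamma> upd] by (simp add: p_def w_def y_def v_def defs)
  have sep: "0 \<le> (y k - z) \<bullet> v k" if "z \<in> Z" for z k
    using A B \<gamma> memA memB res that unfolding y_def v_def Z_def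
    by (intro splitting_separation[where A = A and B = B and a = "a k"])
      (auto simp: maximal_monotone_def)

  have fejer_system: "inertial_fejer p w (inertia E) \<alpha> \<eta> Z"
  proof
    fix k
    show "w k = p k + inertia E k *\<^sub>R (p k - p (k - 1))"
      using extra[of k] unfolding extrapolation_step_def w_def p_def
      by (elim conjE) (simp only: scaleR_add_right scaleR_diff_right scaleR_left_commute[of \<gamma>], simp)
    show "0 \<le> inertia E k" "inertia E k \<le> \<alpha>"
      using extra[of k] by (simp_all add: extrapolation_step_def)
    show "inertia E k \<le> inertia E (Suc k)" "\<alpha> < 1"
      by fact+
    show "\<alpha> * (1 + \<alpha>) < \<eta> * (1 - \<alpha>)\<^sup>2"
      unfolding \<eta>_def by fact
    fix z assume z: "z \<in> Z"
    \<comment> \<open>\<open>(2 - \<rho>) / \<rho>\<close> decreases in \<open>\<rho>\<close>, so the largest relaxation is the worst case.\<close>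
    have "\<eta> \<le> (2 - relax E k) / relax E k"
      using relax[of k] relax_pos[of k] by (simp add: \<eta>_def field_simps)
    then have "\<eta> * (norm (p (Suc k) - w k))\<^sup>2
        \<le> (2 - relax E k) / relax E k * (norm (p (Suc k) - w k))\<^sup>2"
      by (intro mult_right_mono) auto
    with relaxed_projection_decrease[OF sep[OF z] cut_nonneg v_nonzero relax_pos proj, of k]
    show "(norm (p (Suc k) - z))\<^sup>2 \<le> (norm (w k - z))\<^sup>2 - \<eta> * (norm (p (Suc k) - w k))\<^sup>2"
      by linarith
  qed
  then interpret inertial_fejer p w "inertia E" \<alpha> \<eta> Z .

  have "Z \<noteq> {}"
    unfolding Z_def by (rule splitting_zeros_nonempty[OF solvable])
  then obtain z0 where z0: "z0 \<in> Z"
    by blast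
  have long: "\<rho>lo * \<kappa> * norm (v k) \<le> norm (p (Suc k) - w k)"
    "\<rho>lo * \<kappa> * norm (y k - w k) \<le> norm (p (Suc k) - w k)" for k
  proof -
    have "\<rho>lo * \<kappa> * t \<le> relax E k * \<kappa> * t" if "0 \<le> t" for t
      using relax(1)[of k] \<kappa> that by (intro mult_right_mono) auto
    from this[of "norm (v k)"] this[of "norm (y k - w k)"]
      relaxed_projection_long[OF cut less_imp_le[OF \<kappa>] v_nonzero relax_pos proj, of k]
    show "\<rho>lo * \<kappa> * norm (v k) \<le> norm (p (Suc k) - w k)"
      "\<rho>lo * \<kappa> * norm (y k - w k) \<le> norm (p (Suc k) - w k)"
      by auto
  qed
  have scaled_null: "u \<longlonglongrightarrow> 0"
    if "\<And>k. \<rho>lo * \<kappa> * norm (u k) \<le> norm (p (Suc k) - w k)" for u :: "nat \<Rightarrow> 'a"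
  proof (rule Lim_null_comparison)
    show "(\<lambda>k. norm (p (Suc k) - w k) / (\<rho>lo * \<kappa>)) \<longlonglongrightarrow> 0"
      using tendsto_divide[OF tendsto_norm_zero[OF step_null[OF z0]] tendsto_const, of "\<rho>lo * \<kappa>"] \<rho> \<kappa>
      by simp
    show "eventually (\<lambda>k. norm (u k) \<le> norm (p (Suc k) - w k) / (\<rho>lo * \<kappa>)) sequentially"
      using that \<rho> \<kappa> by (intro always_eventually allI) (simp add: pos_le_divide_eq mult.commute)
  qed
  have v_null: "v \<longlonglongrightarrow> 0" and yw_null: "(\<lambda>k. y k - w k) \<longlonglongrightarrow> 0"
    by (rule scaled_null, rule long)+
  have wp_null: "(\<lambda>k. w k - p k) \<longlonglongrightarrow> 0"
    using inertial_term_null[OF z0] by (simp add: w)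
  have sum_null: "(\<lambda>k. (s k + \<gamma> *\<^sub>R b k) - p k) \<longlonglongrightarrow> 0"
    using tendsto_add[OF tendsto_add[OF yw_null wp_null] v_null] by (simp add: sum_eq algebra_simps)

  obtain z where z: "p \<longlonglongrightarrow> z"
  proof (rule inertial_fejer_converges[OF fejer_system \<open>Z \<noteq> {}\<close>])
    fix f z assume f: "strict_mono f" "(p \<circ> f) \<longlonglongrightarrow> z"
    have "(\<lambda>j. (s (f j) + \<gamma> *\<^sub>R b (f j)) - p (f j)) \<longlonglongrightarrow> 0"
      using LIMSEQ_subseq_LIMSEQ[OF sum_null f(1)] by (simp add: o_def)
    from tendsto_add[OF this f(2)[unfolded o_def]]
    have "(\<lambda>j. s (f j) + \<gamma> *\<^sub>R b (f j)) \<longlonglongrightarrow> z"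
      by simp
    moreover have "(\<lambda>j. s (f j) - r (f j)) \<longlonglongrightarrow> 0"
      using LIMSEQ_subseq_LIMSEQ[OF v_null f(1)] by (simp add: o_def v_def)
    ultimately show "z \<in> Z"
      unfolding Z_def splitting_zeros_def
      by (rule splitting_limit[OF A B \<gamma> memA memB res]) blast
  qed
  have "(\<lambda>k. s k + \<gamma> *\<^sub>R b k) \<longlonglongrightarrow> z"
    using tendsto_add[OF sum_null z] by simp
  moreover have "(\<lambda>k. s k - r k) \<longlonglongrightarrow> 0"
    using v_null by (simp add: v_def[abs_def])
  ultimately obtain x c where c: "c \<in> B x" "- c \<in> A x" and z_eq: "z = x + \<gamma> *\<^sub>R c"
    and lims: "s \<longlonglongrightarrow> x" "r \<longlonglongrightarrow> x" "b \<longlonglongrightarrow> c" "a \<longlonglongrightarrow> - c"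
    by (rule splitting_limit[OF A B \<gamma> memA memB res])
  have out_lims: "out_s E \<longlonglongrightarrow> x" "out_r E \<longlonglongrightarrow> x"
    using lims(1,2) by (auto simp: out intro: LIMSEQ_imp_Suc)
  have "(\<lambda>k. (1 / \<gamma>) *\<^sub>R (p k - out_r E k)) \<longlonglongrightarrow> (1 / \<gamma>) *\<^sub>R (z - x)"
    by (intro tendsto_intros z out_lims)
  then have "out_b E \<longlonglongrightarrow> c"
    using \<gamma> by (simp add: p_def z_eq)
  then show ?thesis
    using c lims(3,4) out_lims zero_in_set_sumI[OF c] unfolding defs by blast
qed

theorem theorem3p3:
  fixes A B :: "real ^ 'n \<Rightarrow> (real ^ 'n) set"
    and P :: "(real ^ 'n) procedure"
    and E :: "(real ^ 'n) execution"
    and \<gamma> \<alpha> \<sigma> \<rho>lo \<rho>hi \<beta> :: real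
  assumes "maximal_monotone A" and "maximal_monotone B"
    and "{x. 0 \<in> A x + B x} \<noteq> {}"
    and "B_procedure B P"
    and "0 < \<gamma>" and "0 \<le> \<alpha>" and "\<alpha> < 1" and "0 \<le> \<sigma>" and "\<sigma> < 1"
    and "0 < \<rho>lo" and "\<rho>lo < \<rho>hi" and "\<rho>hi < 2"
    and "0 < \<beta>" and "\<alpha> < \<beta>" and "\<beta> < 1"
    and "\<And>k. 0 \<le> inertia E k \<and> inertia E k \<le> inertia E (Suc k) \<and> inertia E (Suc k) \<le> \<alpha>"
    and "\<rho>hi = 2 * (\<beta> - 1)\<^sup>2 / (2 * (\<beta> - 1)\<^sup>2 + 3 * \<beta> - 1)"
  shows
    "(runs_forever A P \<gamma> \<alpha> \<sigma> \<rho>lo \<rho>hi E \<longrightarrow>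
        (\<exists>x b. 0 \<in> A x + B x \<and> b \<in> B x \<and> - b \<in> A x \<and>
           out_s E \<longlonglongrightarrow> x \<and> out_r E \<longlonglongrightarrow> x \<and>
           (\<lambda>k. in_b E k (ell E k)) \<longlonglongrightarrow> b \<and> out_b E \<longlonglongrightarrow> b \<and>
           (\<lambda>k. in_a E k (ell E k)) \<longlonglongrightarrow> - b))
     \<and> (\<forall>K. 0 < \<sigma> \<and> inner_loop_stuck_at A P \<gamma> \<alpha> \<sigma> \<rho>lo \<rho>hi E K \<longrightarrow>
        (\<exists>x b. 0 \<in> A x + B x \<and> b \<in> B x \<and> - b \<in> A x \<and>
           in_s E K \<longlonglongrightarrow> x \<and> in_r E K \<longlonglongrightarrow> x \<and>
           in_b E K \<longlonglongrightarrow> b \<and> in_a E K \<longlonglongrightarrow> - b))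
     \<and> (\<forall>K. stops_at A P \<gamma> \<alpha> \<sigma> \<rho>lo \<rho>hi E K \<longrightarrow>
        (let z = in_s E K (ell E K) in z = in_r E K (ell E K) \<and> 0 \<in> A z + B z))"
proof (intro conjI allI impI)
  have "\<alpha> * (1 + \<alpha>) < (2 - \<rho>hi) / \<rho>hi * (1 - \<alpha>)\<^sup>2"
    by (rule relaxation_bound_admissible[OF assms(6,14,15,17)])
  then show "\<exists>x b. 0 \<in> A x + B x \<and> b \<in> B x \<and> - b \<in> A x \<and>
      out_s E \<longlonglongrightarrow> x \<and> out_r E \<longlonglongrightarrow> x \<and>
      (\<lambda>k. in_b E k (ell E k)) \<longlonglongrightarrow> b \<and> out_b E \<longlonglongrightarrow> b \<and>
      (\<lambda>k. in_a E k (ell E k)) \<longlonglongrightarrow> - b"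
    if "runs_forever A P \<gamma> \<alpha> \<sigma> \<rho>lo \<rho>hi E"
    using infinite_execution_converges[OF assms(1-5,7-10) _ _ that] assms(16) by blast
next
  fix K
  assume "0 < \<sigma> \<and> inner_loop_stuck_at A P \<gamma> \<alpha> \<sigma> \<rho>lo \<rho>hi E K"
  then show "\<exists>x b. 0 \<in> A x + B x \<and> b \<in> B x \<and> - b \<in> A x \<and>
      in_s E K \<longlonglongrightarrow> x \<and> in_r E K \<longlonglongrightarrow> x \<and> in_b E K \<longlonglongrightarrow> b \<and> in_a E K \<longlonglongrightarrow> - b"
    using stuck_execution_converges[OF assms(1,2,4,5)] by blast
next
  fix K
  assume stop: "stops_at A P \<gamma> \<alpha> \<sigma> \<rho>lo \<rho>hi E K"
  then show "let z = in_s E K (ell E K) in z = in_r E K (ell E K) \<and> 0 \<in> A z + B z"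
    using stopped_execution_solves[OF assms(4,5) stop] by (simp add: stops_at_def Let_def)
qed

end
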